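(* For each integer $\ell\ge 0$, the transposed Boros-Moll sequence $\{d_\ell(m)\}_{m\ge \ell}$ is strictly extended reverse ultra log-concave. That is, for all integers $\ell\ge 0$ and $m\ge \ell+1$, $$\left(\frac{d_\ell(m)}{\binom{m}{\ell}}\right)^2 < \left(\frac{d_\ell(m-1)}{\binom{m-1}{\ell}}\right)\cdot\left(\frac{d_\ell(m+1)}{\binom{m+1}{\ell}}\right),$$ or, equivalently, $$\frac{d_\ell^2(m)}{d_\ell(m-1)\,d_\ell(m+1)} < \frac{(m-\ell+1)m}{(m-\ell)(m+1)}.$$
   Context: For integers $0\le \ell\le m$, the Boros-Moll numbers are $$d_\ell(m)=2^{-2m}\sum_{k=\ell}^m 2^k \binom{2m-2k}{m-k}\binom{m+k}{k}\binom{k}{\ell},$$ and $d_\ell^2(m)$ denotes $(d_\ell(m))^2$. For fixed $\ell$, the sequence $\{d_\ell(m)\}_{m\ge\ell}$ (indexed by $m$) is called a transposed Boros-Moll sequence. A sequence $\{a_i\}_{i\ge k}$ of positive real numbers is called strictly extended reverse ultra log-concave if $\left(a_i/\binom{i}{k}\right)^2<\left(a_{i-1}/\binom{i-1}{k}\right)\left(a_{i+1}/\binom{i+1}{k}\right)$ for all $i\ge k+1$. *)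

theory Defs
  imports Complex_Main
begin

text \<open>Only used for \<open>l \<le> m\<close>, where none of the natural-number subtractions truncates;
  for \<open>l > m\<close> the sum is empty.\<close>

definition boros_moll :: "nat \<Rightarrow> nat \<Rightarrow> real" where
  "boros_moll l m =
     1 / 2 ^ (2 * m) *
     (\<Sum>k = l..m. 2 ^ k * real ((2 * m - 2 * k) choose (m - k)) *
                    real ((m + k) choose k) * real (k choose l))"

text \<open>The sequence is indexed by \<open>i \<ge> k\<close>; values of \<open>a\<close> below \<open>k\<close> are ignored. Positivity of
  the sequence is part of the notion.\<close>

definition strict_ext_rev_ultra_log_concave :: "nat \<Rightarrow> (nat \<Rightarrow> real) \<Rightarrow> bool" where
  "strict_ext_rev_ultra_log_concave k a \<longleftrightarrow>
     (\<forall>i\<ge>k. 0 < a i) \<and>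
     (\<forall>i\<ge>k + 1. (a i / real (i choose k))\<^sup>2
        < (a (i - 1) / real ((i - 1) choose k)) * (a (i + 1) / real ((i + 1) choose k)))"

end

theory Submission
  imports Defs
begin

text \<open>Write \<open>y\<^sub>M\<close> for twice the quotient of consecutive terms \<open>a\<^sub>M / a\<^sub>M\<^sub>-\<^sub>1\<close>, where
  \<open>a\<^sub>M = d\<^sub>l(M) / (M choose l)\<close>; the claim is that \<open>y\<close> is strictly increasing. A three-term
  recurrence for \<open>d\<^sub>l\<close>, obtained by creative telescoping, becomes a Riccati recurrence
  \<open>y\<^sub>M\<^sub>+\<^sub>1 = f\<^sub>M(y\<^sub>M)\<close> with \<open>f\<^sub>M\<close> increasing, so that \<open>y\<^sub>M < y\<^sub>M\<^sub>+\<^sub>1\<close> says that \<open>y\<^sub>M\<close> lies strictly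
  between the two fixed points of \<open>f\<^sub>M\<close>, that is, \<open>g\<^sub>M(y\<^sub>M) < 0\<close> for a quadratic \<open>g\<^sub>M\<close>. As \<open>f\<^sub>M\<close>
  maps the interval between its fixed points into itself, also \<open>g\<^sub>M(y\<^sub>M\<^sub>+\<^sub>1) < 0\<close>; and
  \<open>g\<^sub>M\<^sub>+\<^sub>1 \<le> g\<^sub>M\<close> on \<open>[4 - 1/(M+1), 4]\<close>, an interval that contains \<open>y\<^sub>M\<^sub>+\<^sub>1\<close>. So
  \<open>g\<^sub>M\<^sub>+\<^sub>1(y\<^sub>M\<^sub>+\<^sub>1) < 0\<close> and the induction continues.\<close>

section \<open>The induction step for the Riccati recurrence\<close>

text \<open>Since \<open>C > 0\<close>, the map
  \<open>y \<mapsto> (B - C / y) / (M + 1)\<^sup>2\<close> is increasing, so the bounds on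
  \<open>y'\<close> come from evaluating it at the ends \<open>4 - 1 / M\<close> and
  \<open>4\<close>. The third conclusion is
  \<open>g\<^sub>M\<^sub>+\<^sub>1(y') < 0\<close>.\<close>

lemma ratio_next:
  fixes l M y y' :: real
  assumes "0 \<le> l" "l < M" "1 \<le> M" "4 - 1 / M \<le> y" "y \<le> 4"
    and rec: "(M + 1)\<^sup>2 * (y' * y) = (8*M\<^sup>2 + 8*M + 3 - 4*l\<^sup>2) * y - (1 - l\<^sup>2/M\<^sup>2) * (16*M\<^sup>2 - 1)"
    and less: "y < y'"
  shows "4 - 1 / (M + 1) \<le> y'" "y' \<le> 4"
    "(M + 2)\<^sup>2 * y'\<^sup>2 < (8*(M+1)\<^sup>2 + 8*(M+1) + 3 - 4*l\<^sup>2) * y' - (1 - l\<^sup>2/(M+1)\<^sup>2) * (16*(M+1)\<^sup>2 - 1)"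
proof -
  define B where "B = 8*M\<^sup>2 + 8*M + 3 - 4*l\<^sup>2"
  define C where "C = (1 - l\<^sup>2/M\<^sup>2) * (16*M\<^sup>2 - 1)"
  have M: "M > 0" and "M \<noteq> 0" "M + 1 \<noteq> 0" using assms by auto
  have "1 / M \<le> 1" using assms by simp
  then have y: "y > 0" using assms by linarith
  have "l\<^sup>2 < M\<^sup>2" using assms by (simp add: power_strict_mono)
  moreover have "1 \<le> M\<^sup>2" using assms by simp
  ultimately have C: "C > 0" unfolding C_def using M by (intro mult_pos_pos) auto
  have y': "(M + 1)\<^sup>2 * y' = B - C / y"
    using rec y unfolding B_def C_def by (simp add: field_simps)
  have "C / y \<le> C / (4 - 1 / M)"
    using \<open>1 / M \<le> 1\<close> assms C y by (intro divide_left_mono mult_pos_pos) linarith+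
  also have "\<dots> = (M\<^sup>2 - l\<^sup>2) * (4*M + 1) / M"
  proof -
    have "4 - 1 / M = (4*M - 1) / M" "4*M - 1 \<noteq> 0" using assms by (auto simp: field_simps)
    moreover have "C = (M\<^sup>2 - l\<^sup>2) * (4*M + 1) * (4*M - 1) / M\<^sup>2"
      unfolding C_def using M by (simp add: field_simps power2_eq_square)
    ultimately show ?thesis using M by (simp add: power2_eq_square)
  qed
  also have "\<dots> = 4*M\<^sup>2 + M - 4*l\<^sup>2 - l\<^sup>2 / M"
    using M by (simp add: field_simps power2_eq_square)
  finally have "(M + 1)\<^sup>2 * y' \<ge> 4*M\<^sup>2 + 7*M + 3 + l\<^sup>2 / M"
    unfolding y' B_def by simp
  moreover have "l\<^sup>2 / M \<ge> 0" using M by simp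
  moreover have "(M + 1)\<^sup>2 * (4 - 1 / (M + 1)) = 4*M\<^sup>2 + 7*M + 3"
    using M by (simp add: field_simps power2_eq_square)
  ultimately have "(M + 1)\<^sup>2 * (4 - 1 / (M + 1)) \<le> (M + 1)\<^sup>2 * y'" by linarith
  then show lo: "4 - 1 / (M + 1) \<le> y'"
    using M by (simp only: mult_le_cancel_left_pos zero_less_power)
  have "C / 4 \<le> C / y"
    using assms C y by (intro divide_left_mono mult_pos_pos) auto
  moreover have "C / 4 = 4*M\<^sup>2 - 4*l\<^sup>2 - 1/4 + l\<^sup>2 / M\<^sup>2 / 4"
    unfolding C_def using M by (simp add: field_simps)
  moreover have "l\<^sup>2 / M\<^sup>2 / 4 \<ge> 0" by simp
  moreover have "(M + 1)\<^sup>2 * 4 = 4*M\<^sup>2 + 8*M + 4" by (simp add: power2_sum)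
  ultimately have "(M + 1)\<^sup>2 * y' \<le> (M + 1)\<^sup>2 * 4"
    unfolding y' B_def by linarith
  then show hi: "y' \<le> 4"
    using M by (simp only: mult_le_cancel_left_pos zero_less_power)
  \<comment> \<open>The recurrence is substituted for only one of the two factors \<open>y'\<close>;
    what remains has the sign of \<open>y - y'\<close>.\<close>
  have "(M + 1)\<^sup>2 * y'\<^sup>2 - B * y' + C = y' * ((M + 1)\<^sup>2 * y') - B * y' + C"
    by (simp add: power2_eq_square)
  also have "\<dots> = C * (1 - y' / y)"
    unfolding y' by (simp add: algebra_simps)
  also have "\<dots> < 0"
    using C less y by (simp add: mult_pos_neg)
  finally have g: "(M + 1)\<^sup>2 * y'\<^sup>2 - B * y' + C < 0" .
  \<comment> \<open>Expanding around 4 removes the constant term of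
    \<open>g\<^sub>M\<^sub>+\<^sub>1 - g\<^sub>M\<close>, apart from the difference of the
    \<open>l\<^sup>2\<close> quotients, which is at most 0.\<close>
  define z where "z = 4 - y'"
  have z: "0 \<le> z" "z \<le> 1 / (M + 1)" using lo hi by (auto simp: z_def)
  have "(2*M + 3) * z \<le> (2*M + 3) * (1 / (M + 1))" using z M by (intro mult_left_mono) auto
  also have "\<dots> \<le> 8" using M by (simp add: field_simps)
  finally have "z * ((2*M + 3) * z - 8) \<le> 0" using z by (simp add: mult_nonneg_nonpos)
  moreover have "l\<^sup>2/(M+1)\<^sup>2 \<le> l\<^sup>2/M\<^sup>2"
    using M by (intro divide_left_mono power_mono) auto
  moreover have "((M + 2)\<^sup>2 * y'\<^sup>2 - (8*(M+1)\<^sup>2 + 8*(M+1) + 3 - 4*l\<^sup>2) * y' + (1 - l\<^sup>2/(M+1)\<^sup>2) * (16*(M+1)\<^sup>2 - 1))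
      - ((M + 1)\<^sup>2 * y'\<^sup>2 - B * y' + C)
    = z * ((2*M + 3) * z - 8) + (l\<^sup>2/(M+1)\<^sup>2 - l\<^sup>2/M\<^sup>2)"
    unfolding z_def B_def C_def using M \<open>M + 1 \<noteq> 0\<close>
    by (simp add: left_diff_distrib right_diff_distrib) (simp add: algebra_simps power2_eq_square)
  ultimately show "(M + 2)\<^sup>2 * y'\<^sup>2 < (8*(M+1)\<^sup>2 + 8*(M+1) + 3 - 4*l\<^sup>2) * y' - (1 - l\<^sup>2/(M+1)\<^sup>2) * (16*(M+1)\<^sup>2 - 1)"
    using g by linarith
qed

section \<open>Boros-Moll numbers as sums of hypergeometric terms\<close>

text \<open>The coefficient of \<open>x^n\<close> in \<open>(1 - x)^(-1/2)\<close>. Absorbing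
  \<open>4 ^ n\<close> leaves only \<open>1 / 2 ^ k\<close> of the powers of 2 in the
  summand.\<close>

definition central_weight :: "nat \<Rightarrow> real" where
  "central_weight n = real ((2 * n) choose n) / 4 ^ n"

lemma central_weight_0 [simp]: "central_weight 0 = 1"
  by (simp add: central_weight_def)

lemma central_binomial_Suc:
  "real (2 * Suc n choose Suc n) = real (2 * n choose n) * (2 * (2 * real n + 1) / (real n + 1))"
proof -
  have "Suc n * (Suc (Suc (2*n)) choose Suc n) = Suc (Suc (2*n)) * (Suc (2*n) choose n)"
    by (rule Suc_times_binomial)
  moreover have "Suc n * (Suc (2*n) choose n) = Suc (2*n) * (2*n choose n)"
    using Suc_times_binomial_eq[of "2*n" n] binomial_symmetric[of n "Suc (2*n)"]
    by (simp add: Suc_diff_le mult.commute)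
  ultimately have "Suc n * (2 * Suc n choose Suc n) = Suc n * (2 * (Suc (2*n) choose n))"
    "real (Suc n) * real (Suc (2*n) choose n) = real (Suc (2*n)) * real (2*n choose n)"
    unfolding of_nat_mult[symmetric] by (simp_all del: binomial_Suc_Suc)
  then have "(2 * Suc n choose Suc n) = 2 * (Suc (2*n) choose n)"
    "real (Suc (2*n) choose n) = real (2*n choose n) * (2 * real n + 1) / (real n + 1)"
    by (simp_all only: mult_cancel1) (simp_all add: field_simps del: binomial_Suc_Suc)
  then show ?thesis by (simp del: binomial_Suc_Suc mult_Suc_right)
qed

lemma central_weight_Suc:
  "central_weight (Suc n) = central_weight n * (2 * real n + 1) / (2 * real n + 2)"
  unfolding central_weight_def central_binomial_Suc
  by (simp add: divide_simps) (simp add: algebra_simps)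

definition summand :: "nat \<Rightarrow> nat \<Rightarrow> nat \<Rightarrow> real" where
  "summand l m k = central_weight (m - k) * real ((m + k) choose k) * real (k choose l) / 2 ^ k"

lemma boros_moll_eq_sum: "boros_moll l m = (\<Sum>k = l..m. summand l m k)"
  unfolding boros_moll_def sum_distrib_left
proof (rule sum.cong[OF refl])
  fix k assume "k \<in> {l..m}"
  then obtain n where m: "m = k + n" using le_Suc_ex by auto
  have "(2::real) ^ (2 * m) = 2 ^ k * 2 ^ k * 4 ^ n"
    unfolding m by (simp add: power_add power_mult add_mult_distrib2 mult_2 flip: power_mult_distrib)
  then show "1 / 2 ^ (2 * m) * (2 ^ k * real (2 * m - 2 * k choose (m - k)) * real (m + k choose k) * real (k choose l))
    = summand l m k"
    unfolding summand_def central_weight_def by (simp add: m field_simps flip: diff_mult_distrib2)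
qed

lemma boros_moll_pos: "l \<le> m \<Longrightarrow> 0 < boros_moll l m"
  unfolding boros_moll_eq_sum summand_def central_weight_def
  by (intro sum_pos) (auto intro!: mult_pos_pos divide_pos_pos)

lemma binomial_Suc_left:
  "real (Suc m + k choose k) * (real m + 1) = real (m + k choose k) * (real m + real k + 1)"
proof -
  have "Suc m * (Suc (m + k) choose Suc m) = Suc (m + k) * (m + k choose m)"
    by (rule Suc_times_binomial)
  moreover have "(Suc (m + k) choose Suc m) = (Suc m + k choose k)" "(m + k choose m) = (m + k choose k)"
    using binomial_symmetric[of k "Suc m + k"] binomial_symmetric[of k "m + k"] by simp_all
  ultimately have "real (Suc m) * real (Suc m + k choose k) = real (Suc (m + k)) * real (m + k choose k)"
    by (metis of_nat_mult)
  then show ?thesis by (simp add: algebra_simps del: binomial_Suc_Suc)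
qed

text \<open>With the index \<open>m + 2\<close> in the central factor, all three shifts \<open>m, m + 1, m + 2\<close> of the summand
  are rational multiples of the weight, and these multiples vanish where the summand is cut
  off (\<open>k = m + 1, m + 2\<close>).\<close>

definition weight :: "nat \<Rightarrow> nat \<Rightarrow> nat \<Rightarrow> real" where
  "weight l m k = central_weight (m + 2 - k) * real ((m + k) choose k) * real (k choose l) / 2 ^ k"

lemma summand_shift_2:
  "summand l (m + 2) k = weight l m k * (real m + real k + 1) * (real m + real k + 2) / ((real m + 1) * (real m + 2))"
  using binomial_Suc_left[of m k] binomial_Suc_left[of "Suc m" k]
  unfolding summand_def weight_def
  by (simp add: divide_simps del: binomial_Suc_Suc) (simp add: algebra_simps del: binomial_Suc_Suc; algebra)


text \<open>At \<open>k = m + 2\<close> the right side is 0, but \<open>m + 1 - k\<close> truncates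
  to 0 and the left side is positive for \<open>l \<le> k\<close>; hence the bound on
  \<open>k\<close>.\<close>

lemma summand_shift_1:
  assumes "k \<le> m + 1"
  shows "summand l (m + 1) k
    = weight l m k * (real m + real k + 1) * (2 * (real m + 2 - real k)) / ((real m + 1) * (2 * real m + 3 - 2 * real k))"
proof -
  obtain n where n: "m + 1 = k + n" using assms le_Suc_ex by blast
  then have *: "m + 2 - k = Suc n" "m + 1 - k = n" "real n = real m + 1 - real k" by auto
  have b: "real (m + 1 + k choose k) = real (m + k choose k) * (real m + real k + 1) / (real m + 1)"
    using binomial_Suc_left[of m k] by (simp add: field_simps del: binomial_Suc_Suc)
  have c: "central_weight n = central_weight (Suc n) * (2 * real n + 2) / (2 * real n + 1)"
    by (simp add: central_weight_Suc)
  show ?thesis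
    unfolding summand_def weight_def b * c by (simp add: *(3) algebra_simps)
qed

lemma summand_shift_0:
  assumes "k \<le> m"
  shows "summand l m k = weight l m k * (4 * (real m + 2 - real k) * (real m + 1 - real k))
    / ((2 * real m + 3 - 2 * real k) * (2 * real m + 1 - 2 * real k))"
proof -
  obtain n where n: "m = k + n" using assms le_Suc_ex by blast
  then have *: "m + 2 - k = Suc (Suc n)" "m - k = n" "real n = real m - real k" by auto
  have c: "central_weight n = central_weight (Suc (Suc n)) * (4 * (real n + 2) * (real n + 1))
      / ((2 * real n + 3) * (2 * real n + 1))"
    by (simp add: central_weight_Suc divide_simps) (simp add: algebra_simps)
  show ?thesis
    unfolding summand_def weight_def *(1,2) c unfolding n by (simp add: mult_ac)
qed

text \<open>Each of the three factors of \<open>weight\<close> has a rational quotient; the two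
  absorption identities for the binomials share a factor \<open>k + 1\<close>, which
  cancels.\<close>

lemma weight_Suc:
  assumes "l \<le> k" "k \<le> m + 1"
  shows "weight l m (Suc k)
    = weight l m k * (real m + real k + 1) * (real m + 2 - real k) / ((real k + 1 - real l) * (2 * real m + 3 - 2 * real k))"
proof -
  obtain n where n: "m + 1 = k + n" using assms le_Suc_ex by blast
  then have *: "m + 2 - k = Suc n" "m + 2 - Suc k = n" "real n = real m + 1 - real k" by auto
  have "Suc k * (Suc (m + k) choose Suc k) = Suc (m + k) * (m + k choose k)"
    by (rule Suc_times_binomial)
  then have "real (Suc k) * real (m + Suc k choose Suc k) = real (Suc (m + k)) * real (m + k choose k)"
    by (metis of_nat_mult add_Suc_right)
  then have a: "real (m + Suc k choose Suc k) = real (m + k choose k) * (real m + real k + 1) / (real k + 1)"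
    by (simp add: field_simps del: binomial_Suc_Suc)
  have "(Suc k - l) * (Suc k choose l) = Suc k * (k choose l)"
    using binomial_absorb_comp[of "Suc k" l] by simp
  then have "real (Suc k - l) * real (Suc k choose l) = real (Suc k) * real (k choose l)"
    by (metis of_nat_mult)
  then have b: "real (Suc k choose l) = real (k choose l) * (real k + 1) / (real k + 1 - real l)"
    using assms by (simp add: field_simps del: binomial_Suc_Suc)
  have c: "central_weight n = central_weight (Suc n) * (2 * real n + 2) / (2 * real n + 1)"
    by (simp add: central_weight_Suc)
  show ?thesis
    unfolding weight_def a b * c by (simp add: *(3) divide_simps) (simp add: algebra_simps)
qed

section \<open>Creative telescoping and the three-term recurrence\<close>

text \<open>The quadratic in \<open>k\<close> is found from Zeilberger's ansatz: its leading coefficient is forced, and the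
  identity below determines its values at \<open>k = -m-1\<close> and \<open>k = m+2\<close>.\<close>

definition wz_cert :: "real \<Rightarrow> real \<Rightarrow> real \<Rightarrow> real" where
  "wz_cert l m k = 16*(m+2-l)*(k+m+1)*(k-m-2) + 8*(2*m+3)*(m+2) - 8*(2*m+1)*(2*m+3)*(k-m-2)"

text \<open>Put \<open>G k = weight l m k * (k - l) * wz_cert l m k / (2*m + 3 - 2*k)\<close>. Up to
  the common factor \<open>weight l m k\<close> and the two odd denominators, the left side is
  \<open>G (k + 1) - G k\<close> and the right side is the recurrence applied to the
  summand.\<close>

lemma wz_cert_identity:
  "(m+k+1)*(m+2-k)*wz_cert l m (k+1) - (k-l)*(2*m+1-2*k)*wz_cert l m k
   = 4*(m+2-l)*(m+k+1)*(m+k+2)*((2*m+3-2*k)*(2*m+1-2*k))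
     - 4*(8*m\<^sup>2+24*m+19-4*l\<^sup>2)*(m+k+1)*(m+2-k)*(2*m+1-2*k)
     + 4*(m+l+1)*(4*m+3)*(4*m+5)*(m+2-k)*(m+1-k)"
  unfolding wz_cert_def by algebra

text \<open>The sum of \<open>G (k + 1) - G k\<close> telescopes to 0: the factor
  \<open>k - l\<close> kills the lower end, the factor \<open>m + 2 - k\<close> the upper
  one.\<close>

lemma boros_moll_recurrence:
  assumes "l \<le> m"
  shows "4 * (real m + 2 - real l) * (real m + 1) * (real m + 2) * boros_moll l (m + 2)
    = 2 * (real m + 1) * (8 * (real m)\<^sup>2 + 24 * real m + 19 - 4 * (real l)\<^sup>2) * boros_moll l (m + 1)
      - (real m + real l + 1) * (4 * real m + 3) * (4 * real m + 5) * boros_moll l m"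
proof -
  define a2 a1 a0 where "a2 = 4 * (real m + 2 - real l) * (real m + 1) * (real m + 2)"
    and "a1 = 2 * (real m + 1) * (8 * (real m)\<^sup>2 + 24 * real m + 19 - 4 * (real l)\<^sup>2)"
    and "a0 = (real m + real l + 1) * (4 * real m + 3) * (4 * real m + 5)"
  define f2 f1 f0 where "f2 k = summand l (m + 2) k"
    and "f1 k = weight l m k * (real m + real k + 1) * (2 * (real m + 2 - real k)) / ((real m + 1) * (2 * real m + 3 - 2 * real k))"
    and "f0 k = weight l m k * (4 * (real m + 2 - real k) * (real m + 1 - real k))
      / ((2 * real m + 3 - 2 * real k) * (2 * real m + 1 - 2 * real k))" for k
  have d2: "boros_moll l (m + 2) = (\<Sum>k = l..m+2. f2 k)"
    by (simp add: boros_moll_eq_sum f2_def)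
  have "boros_moll l (m + 1) = (\<Sum>k = l..m+1. f1 k)"
    unfolding boros_moll_eq_sum f1_def by (intro sum.cong refl summand_shift_1) auto
  also have "\<dots> = (\<Sum>k = l..m+2. f1 k)"
    using assms by (simp add: f1_def)
  finally have d1: "boros_moll l (m + 1) = (\<Sum>k = l..m+2. f1 k)" .
  have "boros_moll l m = (\<Sum>k = l..m. f0 k)"
    unfolding boros_moll_eq_sum f0_def by (intro sum.cong refl summand_shift_0) auto
  also have "\<dots> = (\<Sum>k = l..m+2. f0 k)"
    using assms by (simp add: f0_def)
  finally have d0: "boros_moll l m = (\<Sum>k = l..m+2. f0 k)" .
  define T where "T k = a2 * f2 k - a1 * f1 k + a0 * f0 k" for k
  \<comment> \<open>Both are odd integers, so they are nonzero even when negative, as at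
    \<open>k = m + 2\<close>.\<close>
  have odd: "2 * real m + 3 - 2 * real k \<noteq> 0" "2 * real m + 1 - 2 * real k \<noteq> 0" for k
  proof -
    have "2 * int m + 3 - 2 * int k \<noteq> 0" "2 * int m + 1 - 2 * int k \<noteq> 0" by presburger+
    then show "2 * real m + 3 - 2 * real k \<noteq> 0" "2 * real m + 1 - 2 * real k \<noteq> 0" by linarith+
  qed
  have T: "T k = weight l m k * ((real m + real k + 1) * (real m + 2 - real k) * wz_cert l m (real k + 1)
        - (real k - real l) * (2 * real m + 1 - 2 * real k) * wz_cert l m k)
      / ((2 * real m + 3 - 2 * real k) * (2 * real m + 1 - 2 * real k))" for k
  proof -
    define w u v where "w = weight l m k" and "u = 2 * real m + 3 - 2 * real k" and "v = 2 * real m + 1 - 2 * real k"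
    have uv: "u \<noteq> 0" "v \<noteq> 0" using odd[of k] by (simp_all add: u_def v_def)
    have m: "real m + 1 \<noteq> 0" "real m + 2 \<noteq> 0" by linarith+
    have "a2 * f2 k = w * (4 * (real m + 2 - real l) * (real m + real k + 1) * (real m + real k + 2) * (u * v)) / (u * v)"
      unfolding a2_def f2_def summand_shift_2 w_def using uv m by simp
    moreover have "a1 * f1 k = w * (4 * (8 * (real m)\<^sup>2 + 24 * real m + 19 - 4 * (real l)\<^sup>2)
        * (real m + real k + 1) * (real m + 2 - real k) * v) / (u * v)"
    proof -
      define X P Q where "X = 8 * (real m)\<^sup>2 + 24 * real m + 19 - 4 * (real l)\<^sup>2"
        and "P = real m + real k + 1" and "Q = real m + 2 - real k"
      show ?thesis
        unfolding a1_def f1_def w_def[symmetric] u_def[symmetric]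
        unfolding X_def[symmetric] P_def[symmetric] Q_def[symmetric] using uv m
        by (simp add: divide_simps)
    qed
    moreover have "a0 * f0 k = w * (4 * (real m + real l + 1) * (4 * real m + 3) * (4 * real m + 5)
        * (real m + 2 - real k) * (real m + 1 - real k)) / (u * v)"
      unfolding a0_def f0_def w_def[symmetric] u_def[symmetric] v_def[symmetric]
      by (simp only: times_divide_eq_right times_divide_eq_left mult_ac)
    ultimately show ?thesis
      unfolding wz_cert_identity T_def
      unfolding w_def[symmetric] u_def[symmetric] v_def[symmetric]
      by (simp only: distrib_left right_diff_distrib add_divide_distrib diff_divide_distrib)
  qed
  \<comment> \<open>This is \<open>G (K + 1)\<close> expressed through \<open>weight\<close> at
    \<open>K\<close>: at \<open>K = m + 2\<close> the index \<open>m + 2 - Suc K\<close> inside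
    \<open>weight l m (Suc K)\<close> would truncate.\<close>
  have partial: "(\<Sum>k = l..K. T k) = weight l m K * ((real m + real K + 1) * (real m + 2 - real K) * wz_cert l m (real K + 1))
      / ((2 * real m + 3 - 2 * real K) * (2 * real m + 1 - 2 * real K))"
    if "l \<le> K" "K \<le> m + 2" for K
    using that
  proof (induction K rule: nat_induct_at_least)
    case base
    then show ?case by (simp add: T)
  next
    case (Suc K)
    \<comment> \<open>The same value written with \<open>weight\<close> at \<open>Suc K\<close>, so
      that it cancels the subtracted part of \<open>T (Suc K)\<close>.\<close>
    have "(\<Sum>k = l..K. T k) = weight l m (Suc K) * (real (Suc K) - real l) * wz_cert l m (real (Suc K))
      / (2 * real m + 3 - 2 * real (Suc K))"
    proof -
      have index: "real (Suc K) - real l = real K + 1 - real l" "real (Suc K) = real K + 1"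
        "2 * real m + 3 - 2 * real (Suc K) = 2 * real m + 1 - 2 * real K" by simp_all
      have "real K + 1 - real l \<noteq> 0" using Suc.hyps by simp
      then have "weight l m (Suc K) * (real K + 1 - real l)
        = weight l m K * (real m + real K + 1) * (real m + 2 - real K) / (2 * real m + 3 - 2 * real K)"
        using weight_Suc[of l K m] Suc by (simp only: le_SucI) (simp add: mult_ac)
      moreover have "(\<Sum>k = l..K. T k) = weight l m K * ((real m + real K + 1) * (real m + 2 - real K) * wz_cert l m (real K + 1))
          / ((2 * real m + 3 - 2 * real K) * (2 * real m + 1 - 2 * real K))"
        using Suc by simp
      ultimately show ?thesis unfolding index by (simp add: mult_ac)
    qed
    then have "(\<Sum>k = l..Suc K. T k) = weight l m (Suc K) * (real (Suc K) - real l) * wz_cert l m (real (Suc K))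
      / (2 * real m + 3 - 2 * real (Suc K)) + T (Suc K)"
      using Suc by simp
    then show ?case
      unfolding T using odd[of "Suc K"] by (simp add: divide_simps) (simp add: algebra_simps)
  qed
  have "(\<Sum>k = l..m+2. T k) = 0"
    using partial[of "m + 2"] assms by simp
  then have "a2 * boros_moll l (m + 2) - a1 * boros_moll l (m + 1) + a0 * boros_moll l m = 0"
    unfolding d2 d1 d0 T_def by (simp only: sum.distrib sum_subtractf sum_distrib_left)
  then show ?thesis
    unfolding a2_def a1_def a0_def by linarith
qed

section \<open>Bounds and monotonicity of the quotients\<close>

text \<open>The index is shifted with respect to the header: \<open>ratio l m\<close> is \<open>y\<^sub>M\<close> for \<open>M = m + 1\<close>.\<close>

definition ratio :: "nat \<Rightarrow> nat \<Rightarrow> real" where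
  "ratio l m = 2 * (real m + 1 - real l) * boros_moll l (m + 1) / ((real m + 1) * boros_moll l m)"

lemma ratio_pos: "l \<le> m \<Longrightarrow> 0 < ratio l m"
  unfolding ratio_def by (intro divide_pos_pos mult_pos_pos boros_moll_pos) auto

text \<open>The middle term \<open>d1\<close> cancels in the product of the two ratios, and
  \<open>(M - l) * (M + l) / M\<^sup>2\<close> becomes
  \<open>1 - l\<^sup>2 / M\<^sup>2\<close>.\<close>

lemma ratio_recurrence:
  assumes "l \<le> m"
  shows "(real m + 2)\<^sup>2 * (ratio l (Suc m) * ratio l m)
    = (8*(real m+1)\<^sup>2 + 8*(real m+1) + 3 - 4*(real l)\<^sup>2) * ratio l m
      - (1 - (real l)\<^sup>2/(real m+1)\<^sup>2) * (16*(real m+1)\<^sup>2 - 1)"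
proof -
  define M where "M = real m + 1"
  have M: "M > 0" "M + 1 > 0" by (auto simp: M_def)
  define d0 d1 d2 where "d0 = boros_moll l m" and "d1 = boros_moll l (m + 1)" and "d2 = boros_moll l (m + 2)"
  have d: "d0 > 0" "d1 > 0" using assms by (auto simp: d0_def d1_def intro: boros_moll_pos)
  have r: "ratio l m = 2 * (M - real l) * d1 / (M * d0)"
    "ratio l (Suc m) = 2 * (M + 1 - real l) * d2 / ((M + 1) * d1)"
    by (simp_all add: ratio_def M_def d0_def d1_def d2_def add_ac)
  have m: "real m = M - 1" by (simp add: M_def)
  have rec: "4 * (M + 1 - real l) * M * (M + 1) * d2
    = 2 * M * (8*M\<^sup>2 + 8*M + 3 - 4*(real l)\<^sup>2) * d1 - (M + real l) * (16*M\<^sup>2 - 1) * d0"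
    using boros_moll_recurrence[OF assms, folded d0_def d1_def d2_def] unfolding m
    by (simp add: algebra_simps power2_eq_square)
  have "(M + 1)\<^sup>2 * (ratio l (Suc m) * ratio l m)
      = (4 * (M + 1 - real l) * M * (M + 1) * d2) * (M - real l) / (M\<^sup>2 * d0)"
    unfolding r using M d by (simp add: divide_simps power2_eq_square) (simp add: algebra_simps)
  also have "\<dots> = (8*M\<^sup>2 + 8*M + 3 - 4*(real l)\<^sup>2) * ratio l m - (1 - (real l)\<^sup>2/M\<^sup>2) * (16*M\<^sup>2 - 1)"
    unfolding rec r using M d by (simp add: divide_simps power2_eq_square) (simp add: algebra_simps)
  finally show ?thesis by (simp add: M_def add_ac)
qed

text \<open>Only \<open>k = l\<close> and \<open>k = l + 1\<close> contribute to
  \<open>boros_moll l (l + 1)\<close>, and both terms are rational multiples of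
  \<open>boros_moll l l\<close>.\<close>

lemma ratio_start: "ratio l l = 4 - 1 / (real l + 1)\<^sup>2"
proof -
  define L where "L = real l + 1"
  have L: "L > 0" "real l = L - 1" by (auto simp: L_def)
  have double: "l + l = 2 * l" by simp
  have d: "boros_moll l l = real (2 * l choose l) / 2 ^ l"
    by (simp add: boros_moll_eq_sum summand_def double)
  have "real (l + 1 + l choose l) = real (2 * l choose l) * ((2 * real l + 1) / (real l + 1))"
    using binomial_Suc_left[of l l] by (simp add: double field_simps del: binomial_Suc_Suc)
  then have 1: "summand l (l + 1) l = boros_moll l l * ((2 * real l + 1) / (2 * (real l + 1)))"
    by (simp add: summand_def d central_weight_Suc del: binomial_Suc_Suc)
  have "summand l (l + 1) (l + 1) = real (2 * Suc l choose Suc l) * (real l + 1) / 2 ^ Suc l"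
    by (simp add: summand_def double del: binomial_Suc_Suc)
  then have 2: "summand l (l + 1) (l + 1) = boros_moll l l * (2 * real l + 1)"
    unfolding central_binomial_Suc d by (simp add: divide_simps) (simp add: algebra_simps)
  have "boros_moll l (l + 1) = summand l (l + 1) l + summand l (l + 1) (l + 1)"
    by (simp add: boros_moll_eq_sum)
  also have "\<dots> = boros_moll l l * ((2 * L - 1) * (2 * L + 1) / (2 * L))"
    unfolding 1 2 L(2) using L(1) by (simp add: field_simps)
  finally have "ratio l l = (2 * L - 1) * (2 * L + 1) / L\<^sup>2"
    using boros_moll_pos[of l l] L(1) by (simp add: ratio_def L(2) power2_eq_square)
  then show ?thesis
    unfolding L_def[symmetric] using L(1) by (simp add: field_simps power2_eq_square)
qed

text \<open>The induction carries the two bounds together with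
  \<open>g\<^sub>M(y\<^sub>M) < 0\<close>; the local fact \<open>less\<close> turns the latter into
  growth by the recurrence.\<close>

lemma ratio_bounds:
  assumes "l \<le> m"
  shows "4 - 1 / (real m + 1) \<le> ratio l m" "ratio l m \<le> 4" "ratio l m < ratio l (Suc m)"
proof -
  have less: "ratio l m < ratio l (Suc m)"
    if "(real m + 2)\<^sup>2 * (ratio l m)\<^sup>2
      < (8*(real m+1)\<^sup>2 + 8*(real m+1) + 3 - 4*(real l)\<^sup>2) * ratio l m
        - (1 - (real l)\<^sup>2/(real m+1)\<^sup>2) * (16*(real m+1)\<^sup>2 - 1)"
      and "l \<le> m" for m
  proof -
    have "(real m + 2)\<^sup>2 * (ratio l m * ratio l m) < (real m + 2)\<^sup>2 * (ratio l (Suc m) * ratio l m)"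
      using that unfolding ratio_recurrence[OF that(2)] by (simp add: power2_eq_square)
    then show ?thesis
      using ratio_pos[OF that(2)] by (simp add: mult_less_cancel_left mult_less_cancel_right)
  qed
  from assms have "4 - 1 / (real m + 1) \<le> ratio l m \<and> ratio l m \<le> 4
    \<and> (real m + 2)\<^sup>2 * (ratio l m)\<^sup>2
      < (8*(real m+1)\<^sup>2 + 8*(real m+1) + 3 - 4*(real l)\<^sup>2) * ratio l m
        - (1 - (real l)\<^sup>2/(real m+1)\<^sup>2) * (16*(real m+1)\<^sup>2 - 1)"
  proof (induction m rule: nat_induct_at_least)
    case base
    define L where "L = real l + 1"
    have L: "L \<ge> 1" "real l = L - 1" by (auto simp: L_def)
    have "1 / L\<^sup>2 \<le> 1 / L" using L(1) by (simp add: field_simps power2_eq_square)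
    \<comment> \<open>This is \<open>- g\<^sub>M\<close> at the starting value, where
      \<open>M = L\<close>; the numerator on the right is positive for
      \<open>L \<ge> 1\<close>.\<close>
    moreover have "(8*L\<^sup>2 + 8*L + 3 - 4*(L - 1)\<^sup>2) * (4 - 1 / L\<^sup>2) - (1 - (L - 1)\<^sup>2/L\<^sup>2) * (16*L\<^sup>2 - 1)
        - (L + 1)\<^sup>2 * (4 - 1 / L\<^sup>2)\<^sup>2 = (2*L^3 + 7*L\<^sup>2 - 2*L - 1) / L^4"
      using L(1) by (simp add: divide_simps) (simp add: algebra_simps eval_nat_numeral)
    moreover have "2*L^3 + 7*L\<^sup>2 - 2*L - 1 > 0"
    proof -
      have "L\<^sup>2 \<ge> L" "L^3 \<ge> 1" using L(1) by (simp_all add: power2_eq_square)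
      then show ?thesis using L(1) by linarith
    qed
    ultimately have "(L + 1)\<^sup>2 * (4 - 1 / L\<^sup>2)\<^sup>2
        < (8*L\<^sup>2 + 8*L + 3 - 4*(L - 1)\<^sup>2) * (4 - 1 / L\<^sup>2) - (1 - (L - 1)\<^sup>2/L\<^sup>2) * (16*L\<^sup>2 - 1)"
      using L(1) by (subst diff_gt_0_iff_gt[symmetric]) simp
    moreover have "L - 1 + 1 = L" "L - 1 + 2 = L + 1" by simp_all
    ultimately show ?case
      unfolding ratio_start L(2) using \<open>1 / L\<^sup>2 \<le> 1 / L\<close> by (simp only:) simp
  next
    case (Suc m)
    show ?case
      using ratio_next[of "real l" "real m + 1" "ratio l m" "ratio l (Suc m)"]
        ratio_recurrence[of l m] less[of m] Suc
      by (simp add: add_ac)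
  qed
  then show "4 - 1 / (real m + 1) \<le> ratio l m" "ratio l m \<le> 4" "ratio l m < ratio l (Suc m)"
    using less[of m] assms by auto
qed

section \<open>Back to the Boros-Moll numbers\<close>

text \<open>This is \<open>ratio l (m - 1) < ratio l m\<close> with denominators cleared, the common
  source of both forms of the theorem.\<close>

lemma boros_moll_ratio_less:
  assumes "l + 1 \<le> m"
  shows "(boros_moll l m)\<^sup>2 * ((real m - real l) * (real m + 1))
    < boros_moll l (m - 1) * boros_moll l (m + 1) * ((real m - real l + 1) * real m)"
proof -
  obtain n where n: "m = Suc n" "l \<le> n" using assms by (cases m) auto
  define d0 d1 d2 where "d0 = boros_moll l n" and "d1 = boros_moll l m" and "d2 = boros_moll l (m + 1)"
  have d: "d0 > 0" "d1 > 0" using n by (auto simp: d0_def d1_def intro: boros_moll_pos)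
  have m: "real m > 0" using n by simp
  have "ratio l n < ratio l m" using ratio_bounds(3)[OF n(2)] n by simp
  then have "(real m - real l) * d1 / (real m * d0) < (real m + 1 - real l) * d2 / ((real m + 1) * d1)"
  proof -
    have "ratio l n = 2 * ((real m - real l) * d1 / (real m * d0))"
      "ratio l m = 2 * ((real m + 1 - real l) * d2 / ((real m + 1) * d1))"
      by (simp_all add: ratio_def n d0_def d1_def d2_def add_ac)
    then show ?thesis using \<open>ratio l n < ratio l m\<close> by linarith
  qed
  then have "((real m - real l) * d1) * ((real m + 1) * d1) < ((real m + 1 - real l) * d2) * (real m * d0)"
    using d m by (simp add: frac_less_eq divide_less_eq less_divide_eq mult_ac)
  then show ?thesis
    using n by (simp add: d0_def d1_def d2_def power2_eq_square mult_ac diff_add_eq)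
qed

theorem theorem3p1:
  fixes l :: nat
  shows "strict_ext_rev_ultra_log_concave l (\<lambda>m. boros_moll l m)
    \<and> (\<forall>m\<ge>l + 1.
          (boros_moll l m / real (m choose l))\<^sup>2
            < (boros_moll l (m - 1) / real ((m - 1) choose l)) *
              (boros_moll l (m + 1) / real ((m + 1) choose l)))
    \<and> (\<forall>m\<ge>l + 1.
          (boros_moll l m)\<^sup>2 / (boros_moll l (m - 1) * boros_moll l (m + 1))
            < ((real m - real l + 1) * real m) / ((real m - real l) * (real m + 1)))"
proof -
  have ratio: "(boros_moll l m)\<^sup>2 / (boros_moll l (m - 1) * boros_moll l (m + 1))
            < ((real m - real l + 1) * real m) / ((real m - real l) * (real m + 1))"
    if "l + 1 \<le> m" for m
  proof -
    have "0 < boros_moll l (m - 1) * boros_moll l (m + 1)"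
      using that by (intro mult_pos_pos boros_moll_pos) auto
    moreover have "0 < (real m - real l) * (real m + 1)"
      using that by (intro mult_pos_pos) auto
    ultimately show ?thesis
      using boros_moll_ratio_less[OF that] by (simp add: divide_less_eq less_divide_eq mult_ac)
  qed
  have log_convex: "(boros_moll l m / real (m choose l))\<^sup>2
            < (boros_moll l (m - 1) / real ((m - 1) choose l)) *
              (boros_moll l (m + 1) / real ((m + 1) choose l))"
    if "l + 1 \<le> m" for m
  proof -
    \<comment> \<open>Both neighbouring binomials are rational multiples of \<open>B\<close>; their
      product is \<open>B\<^sup>2 * (m - l) * (m + 1) / (m * (m - l + 1))\<close>.\<close>
    define B where "B = real (m choose l)"
    have B: "B > 0" using that by (simp add: B_def)
    have m: "real m - real l > 0" "real m > 0" using that by auto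
    have "(m - l) * (m choose l) = m * ((m - 1) choose l)"
      by (rule binomial_absorb_comp)
    then have "real (m - l) * B = real m * real ((m - 1) choose l)"
      unfolding B_def by (metis of_nat_mult)
    then have 1: "real ((m - 1) choose l) = B * (real m - real l) / real m"
      using that m by (simp add: field_simps)
    have "(m + 1 - l) * (m + 1 choose l) = (m + 1) * (m choose l)"
      using binomial_absorb_comp[of "m + 1" l] by simp
    then have "real (m + 1 - l) * real (m + 1 choose l) = real (m + 1) * B"
      unfolding B_def by (metis of_nat_mult)
    then have 2: "real (m + 1 choose l) = B * (real m + 1) / (real m - real l + 1)"
      using that m by (simp add: field_simps)
    have "(boros_moll l m / B)\<^sup>2 = (boros_moll l m)\<^sup>2 * ((real m - real l) * (real m + 1))
        / (B\<^sup>2 * ((real m - real l) * (real m + 1)))"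
      using m B by (simp add: power_divide)
    also have "\<dots> < boros_moll l (m - 1) * boros_moll l (m + 1) * ((real m - real l + 1) * real m)
        / (B\<^sup>2 * ((real m - real l) * (real m + 1)))"
      using m B boros_moll_ratio_less[OF that] by (intro divide_strict_right_mono mult_pos_pos) auto
    finally show ?thesis
      unfolding 1 2 B_def[symmetric] using m B by (simp add: power2_eq_square mult_ac)
  qed
  show ?thesis
    unfolding strict_ext_rev_ultra_log_concave_def
    using ratio log_convex boros_moll_pos by blast
qed

end
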